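(* Let $\alpha,\beta$ be upsets and $\Gamma\rhd\Delta$ an argument. If $\alpha\subseteq\beta$ and $\Gamma\rhd\Delta$ is $\beta$-symmetric valid, then it is $\alpha$-symmetric valid.
   Context: Language: $\mathcal{L}$ is the propositional language with countably infinitely many atomic sentences and connectives $\neg,\lor$ (other classical connectives defined as usual). An argument $\Gamma\rhd\Delta$ is a pair of finite (possibly empty) sets $\Gamma,\Delta$ of sentences of $\mathcal{L}$. A probabilistic model is $\langle W,\mathcal{A},[\![\cdot]\!],P\rangle$ where $W$ is a nonempty set (of worlds); $\mathcal{A}\subseteq\mathcal{P}(W)$ contains $\emptyset$ and is closed under complement in $W$ and binary union; $[\![\cdot]\!]:\mathcal{L}\to\mathcal{A}$ satisfies $[\![\neg\phi]\!]=W\setminus[\![\phi]\!]$ and $[\![\phi\lor\psi]\!]=[\![\phi]\!]\cup[\![\psi]\!]$; and $P:\mathcal{A}\to[0,1]$ is a finitely additive probability ($P(\emptyset)=0$, $P(W\setminus A)=1-P(A)$, and $P(A\cup B)=P(A)+P(B)$ for disjoint $A,B\in\mathcal{A}$). Write $P(\phi)$ for $P([\![\phi]\!])$. An upset is a set $\alpha\subseteq[0,1]$ with $1\in\alpha$, $0\notin\alpha$, and such that $x\in\alpha$, $x\le y\le 1$ imply $y\in\alpha$. Its mirror image is $\overline{\alpha}=\{x\in[0,1] : 1-x\in\alpha\}$. $\Gamma\rhd\Delta$ is $\alpha$-symmetric valid iff in every probabilistic model, if $P(\gamma)\in\alpha$ for every $\gamma\in\Gamma$, then $P(\delta)\notin\overline{\alpha}$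 for some $\delta\in\Delta$. *)

theory Defs
  imports "HOL-Analysis.Sigma_Algebra"
begin

datatype sentence = Atom nat | Neg sentence | Disj sentence sentence

text \<open>
  The library's \<^const>\<open>algebra\<close> is a family of subsets of \<open>W\<close> containing the empty set and closed
  under complement in \<open>W\<close> and binary union (see \<open>algebra_iff_Un\<close>). The function \<open>P\<close> is total on
  the type, but only its values on \<open>\<A>\<close> are constrained, and only these are ever used.
\<close>

locale prob_model = algebra W \<A>
  for W :: "'w set" and \<A> :: "'w set set" +
  fixes V :: "sentence \<Rightarrow> 'w set" and P :: "'w set \<Rightarrow> real"
  assumes worlds_nonempty: "W \<noteq> {}"
    and V_in: "V \<phi> \<in> \<A>"
    and V_Neg: "V (Neg \<phi>) = W - V \<phi>"
    and V_Disj: "V (Disj \<phi> \<psi>) = V \<phi> \<union> V \<psi>"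
    and P_range: "A \<in> \<A> \<Longrightarrow> P A \<in> {0..1}"
    and P_empty: "P {} = 0"
    and P_compl: "A \<in> \<A> \<Longrightarrow> P (W - A) = 1 - P A"
    and P_union: "A \<in> \<A> \<Longrightarrow> B \<in> \<A> \<Longrightarrow> A \<inter> B = {} \<Longrightarrow> P (A \<union> B) = P A + P B"

definition upset :: "real set \<Rightarrow> bool" where
  "upset \<alpha> \<longleftrightarrow> \<alpha> \<subseteq> {0..1} \<and> 1 \<in> \<alpha> \<and> 0 \<notin> \<alpha> \<and> (\<forall>x y. x \<in> \<alpha> \<and> x \<le> y \<and> y \<le> 1 \<longrightarrow> y \<in> \<alpha>)"

definition mirror :: "real set \<Rightarrow> real set" where
  "mirror \<alpha> = {x \<in> {0..1}. 1 - x \<in> \<alpha>}"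

text \<open>
  HOL cannot quantify over types inside a formula, so the type \<open>'w\<close> from which the worlds are drawn
  is an explicit parameter. Lemma \<open>symmetric_valid_world_type\<close> shows that, for a finite argument,
  validity over any one infinite type gives validity over every type.
\<close>

definition symmetric_valid ::
    "'w itself \<Rightarrow> real set \<Rightarrow> sentence set \<Rightarrow> sentence set \<Rightarrow> bool" where
  "symmetric_valid (_ :: 'w itself) \<alpha> \<Gamma> \<Delta> \<longleftrightarrow>
    (\<forall>(W :: 'w set) \<A> V P. prob_model W \<A> V P \<longrightarrow>
      (\<forall>\<gamma>\<in>\<Gamma>. P (V \<gamma>) \<in> \<alpha>) \<longrightarrow> (\<exists>\<delta>\<in>\<Delta>. P (V \<delta>) \<notin> mirror \<alpha>))"

primrec atoms :: "sentence \<Rightarrow> nat set" where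
  "atoms (Atom n) = {n}"
| "atoms (Neg \<phi>) = atoms \<phi>"
| "atoms (Disj \<phi> \<psi>) = atoms \<phi> \<union> atoms \<psi>"

primrec extend_val :: "'w set \<Rightarrow> (nat \<Rightarrow> 'w set) \<Rightarrow> sentence \<Rightarrow> 'w set" where
  "extend_val W v (Atom n) = v n"
| "extend_val W v (Neg \<phi>) = W - extend_val W v \<phi>"
| "extend_val W v (Disj \<phi> \<psi>) = extend_val W v \<phi> \<union> extend_val W v \<psi>"

lemma finite_atoms: "finite (atoms \<phi>)"
  by (induction \<phi>) auto

lemma (in prob_model) exists_model_over_infinite_type:
  assumes inf: "infinite (UNIV :: 'v set)" and N: "finite N"
  shows "\<exists>(W' :: 'v set) \<A>' V' P'. prob_model W' \<A>' V' P' \<and>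
    (\<forall>\<phi>. atoms \<phi> \<subseteq> N \<longrightarrow> P' (V' \<phi>) = P (V \<phi>))"
proof -
  define g where "g w = {n \<in> N. w \<in> V (Atom n)}" for w
  obtain e :: "nat set \<Rightarrow> 'v" where e: "inj_on e (Pow N)"
    using inf N by (metis finite_Pow_iff inj_on_iff_card_le infinite_arbitrarily_large
        card_image finite_imageI subset_UNIV order_refl)
  define f where "f = e \<circ> g"
  have fg: "f w = f u \<longleftrightarrow> g w = g u" for w u
    using e unfolding f_def g_def inj_on_def by auto
  define W' where "W' = f ` W"
  define pre where "pre X = W \<inter> f -` X" for X
  define \<A>' where "\<A>' = {X. X \<subseteq> W' \<and> pre X \<in> \<A>}"
  define v where "v n = (if n \<in> N then f ` V (Atom n) else {})" for n
  define V' where "V' = extend_val W' v"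
  define P' where "P' X = P (pre X)" for X
  have VW: "V \<phi> \<subseteq> W" for \<phi> using V_in sets_into_space by blast
  have pre_v: "pre (v n) = V (Atom n)" if "n \<in> N" for n
  proof -
    have "w \<in> V (Atom n)" if "w \<in> W" "u \<in> V (Atom n)" "f w = f u" for w u
      using that \<open>n \<in> N\<close> fg[of w u] unfolding g_def by blast
    then show ?thesis using VW[of "Atom n"] that unfolding pre_def v_def by auto
  qed
  have pre_compl: "pre (W' - X) = W - pre X" for X
    unfolding pre_def W'_def by auto
  have pre_un: "pre (X \<union> Y) = pre X \<union> pre Y" for X Y
    unfolding pre_def by auto
  have pre_empty: "pre {} = {}" unfolding pre_def by auto
  have alg: "algebra W' \<A>'"
    unfolding algebra_iff_Un \<A>'_def by (auto simp: pre_compl pre_un pre_empty)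
  have v_in: "v n \<in> \<A>'" for n
    using pre_v[of n] V_in[of "Atom n"] VW[of "Atom n"] pre_empty
    unfolding \<A>'_def by (cases "n \<in> N") (auto simp: v_def W'_def)
  have V'_in: "V' \<phi> \<in> \<A>'" for \<phi>
    using alg v_in unfolding algebra_iff_Un V'_def by (induction \<phi>) auto
  have eq: "pre (V' \<phi>) = V \<phi>" if "atoms \<phi> \<subseteq> N" for \<phi>
    using that unfolding V'_def
    by (induction \<phi>) (auto simp: pre_v pre_compl pre_un V_Neg V_Disj)
  have "prob_model W' \<A>' V' P'"
  proof (intro prob_model.intro alg prob_model_axioms.intro)
    show "W' \<noteq> {}" using worlds_nonempty by (simp add: W'_def)
    show "P' (A \<union> B) = P' A + P' B" if "A \<in> \<A>'" "B \<in> \<A>'" "A \<inter> B = {}" for A B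
    proof -
      have "pre A \<inter> pre B = {}" using that(3) unfolding pre_def by auto
      then show ?thesis using that P_union unfolding \<A>'_def P'_def pre_un by auto
    qed
    show "V' \<phi> \<in> \<A>'" for \<phi> by (rule V'_in)
    show "V' (Neg \<phi>) = W' - V' \<phi>" "V' (Disj \<phi> \<psi>) = V' \<phi> \<union> V' \<psi>" for \<phi> \<psi>
      by (simp_all add: V'_def)
    show "P' A \<in> {0..1}" if "A \<in> \<A>'" for A
      using that P_range unfolding \<A>'_def P'_def by blast
    show "P' {} = 0" by (simp add: P'_def pre_empty P_empty)
    show "P' (W' - A) = 1 - P' A" if "A \<in> \<A>'" for A
      using that P_compl unfolding \<A>'_def P'_def pre_compl by blast
  qed
  moreover have "P' (V' \<phi>) = P (V \<phi>)" if "atoms \<phi> \<subseteq> N" for \<phi>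
    using eq[OF that] by (simp add: P'_def)
  ultimately show ?thesis by blast
qed

lemma symmetric_valid_world_type:
  assumes fin: "finite \<Gamma>" "finite \<Delta>" and inf: "infinite (UNIV :: 'v set)"
    and valid: "symmetric_valid TYPE('v) \<alpha> \<Gamma> \<Delta>"
  shows "symmetric_valid TYPE('w) \<alpha> \<Gamma> \<Delta>"
  unfolding symmetric_valid_def
proof (intro allI impI)
  fix W :: "'w set" and \<A> V P
  assume m: "prob_model W \<A> V P" and prem: "\<forall>\<gamma>\<in>\<Gamma>. P (V \<gamma>) \<in> \<alpha>"
  define N where "N = (\<Union>\<phi>\<in>\<Gamma> \<union> \<Delta>. atoms \<phi>)"
  have "finite N" using fin by (simp add: N_def finite_atoms)
  from prob_model.exists_model_over_infinite_type[OF m inf this]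
  obtain W' :: "'v set" and \<A>' V' P' where m': "prob_model W' \<A>' V' P'"
    and eq: "\<And>\<phi>. atoms \<phi> \<subseteq> N \<Longrightarrow> P' (V' \<phi>) = P (V \<phi>)" by blast
  have same: "P' (V' \<phi>) = P (V \<phi>)" if "\<phi> \<in> \<Gamma> \<union> \<Delta>" for \<phi>
    using that by (intro eq) (auto simp: N_def)
  then have "\<forall>\<gamma>\<in>\<Gamma>. P' (V' \<gamma>) \<in> \<alpha>" using prem by simp
  then obtain \<delta> where "\<delta> \<in> \<Delta>" "P' (V' \<delta>) \<notin> mirror \<alpha>"
    using valid m' unfolding symmetric_valid_def by blast
  then show "\<exists>\<delta>\<in>\<Delta>. P (V \<delta>) \<notin> mirror \<alpha>" using same by force
qed

end

theory Submission
  imports Defs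
begin

text \<open>Both membership conditions of a countermodel, premises in the upset and conclusions in
  its mirror image, are monotone in the upset. So a countermodel for \<open>\<alpha>\<close> is
  already one for \<open>\<beta>\<close>.\<close>

theorem fact39:
  fixes \<alpha> \<beta> :: "real set" and \<Gamma> \<Delta> :: "sentence set"
  assumes "upset \<alpha>" and "upset \<beta>"
    and "finite \<Gamma>" and "finite \<Delta>"
    and "\<alpha> \<subseteq> \<beta>"
    and "symmetric_valid TYPE('w) \<beta> \<Gamma> \<Delta>"
  shows "symmetric_valid TYPE('w) \<alpha> \<Gamma> \<Delta>"
proof -
  have "mirror \<alpha> \<subseteq> mirror \<beta>"
    using \<open>\<alpha> \<subseteq> \<beta>\<close> by (auto simp: mirror_def)
  \<comment> \<open>In a fixed model, premises valued in \<open>\<alpha>\<close> are valued in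
    \<open>\<beta>\<close>; the \<open>\<delta>\<close> this yields avoids
    \<open>mirror \<beta>\<close>, hence also the smaller \<open>mirror \<alpha>\<close>.\<close>
  then show ?thesis
    using assms(5,6) unfolding symmetric_valid_def by (meson subsetD)
qed

end
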